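(* Let $\Psi(u,v)=|u+v|$ and let $m$ be a real number. There exist random variables $U',V'\sim\mathcal U(-\tfrac12,\tfrac12)$ on a common probability space such that $\Psi(U',V')=m$ almost surely if and only if $$m\in\mathfrak C:=\{0\}\cup\Bigl\{\frac1{2N}: N\in\{1,2,\dots\}\Bigr\}.$$
   Context: $\mathcal U(-\tfrac12,\tfrac12)$ is the uniform distribution on $(-\tfrac12,\tfrac12)$. *)

theory Defs
  imports "HOL-Probability.Probability"
begin

definition Psi :: "real \<Rightarrow> real \<Rightarrow> real" where
  "Psi u v = \<bar>u + v\<bar>"

definition uniform_half :: "real measure" where
  "uniform_half = uniform_measure lborel {- 1 / 2 <..< 1 / 2}"

text \<open>Measurability is required separately, since \<^const>\<open>distr\<close> is only meaningful for
  measurable maps.\<close>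

definition has_law :: "'a measure \<Rightarrow> ('a \<Rightarrow> real) \<Rightarrow> real measure \<Rightarrow> bool" where
  "has_law M X \<mu> \<longleftrightarrow> X \<in> borel_measurable M \<and> distr M borel X = \<mu>"

definition uniform_pair_constant :: "'a measure \<Rightarrow> ('a \<Rightarrow> real) \<Rightarrow> ('a \<Rightarrow> real) \<Rightarrow> real \<Rightarrow> bool" where
  "uniform_pair_constant M U V m \<longleftrightarrow>
     prob_space M \<and> has_law M U uniform_half \<and> has_law M V uniform_half \<and>
     (AE x in M. Psi (U x) (V x) = m)"

definition admissible :: "real set" where
  "admissible = {0} \<union> {1 / (2 * real N) | N :: nat. N \<ge> 1}"

end

theory Submission imports Defs
begin

text \<open>
  \<^emph>\<open>Necessity.\<close> If \<open>\<bar>U + V\<bar> = m > 0\<close>, then \<open>-V\<close> is one of \<open>U \<plusminus> m\<close>, and the function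
  \<open>c x = cos (\<pi> x / m)\<close> changes sign under translation by \<open>\<plusminus>m\<close>. As \<open>c\<close> is even,
  \<open>c V = - c U\<close> almost surely. Since \<open>U\<close> and \<open>V\<close> have the same law, \<open>c\<close> has mean
  zero under the uniform distribution. That mean is \<open>(2 m / \<pi>) sin (\<pi> / (2 m))\<close>
  (lemma \<open>uniform_half_cos_mean\<close>), and it vanishes only if \<open>1 / (2 m)\<close> is an integer.

  \<^emph>\<open>Sufficiency.\<close> It is enough to find a map \<open>T\<close> that preserves the uniform distribution and
  satisfies \<open>\<bar>x + T x\<bar> = m\<close> (lemma \<open>uniform_pair_constant_of_map\<close>). For \<open>m = 1 / (2 N)\<close>,
  cut the interval into \<open>2 N\<close> cells of length \<open>m\<close>, exchange the two cells of each consecutive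
  pair by translation, and negate: \<open>T x\<close> is \<open>-m - x\<close> on the odd-numbered cells and \<open>m - x\<close> on
  the even-numbered ones. Each of the two reflections maps the union of its own cells to itself,
  so \<open>T\<close> preserves Lebesgue measure (lemma \<open>lborel_distr_piecewise_reflection\<close>).
  For \<open>m = 0\<close> the first reflection is used everywhere.
\<close>

section \<open>The uniform distribution\<close>

lemma uniform_half_eq_density:
  "uniform_half = density lborel (indicator {- 1 / 2 <..< 1 / 2})"
  unfolding uniform_half_def uniform_measure_def by (simp add: divide_ennreal_def)

lemma space_uniform_half [simp]: "space uniform_half = UNIV"
  and sets_uniform_half [measurable_cong, simp]: "sets uniform_half = sets borel"
  by (simp_all add: uniform_half_def)

lemma AE_uniform_half_iff:
  "(AE x in uniform_half. P x) \<longleftrightarrow> (AE x in lborel. - 1 / 2 < x \<and> x < 1 / 2 \<longrightarrow> P x)"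
  unfolding uniform_half_def by (subst AE_uniform_measure) auto

lemma prob_space_uniform_half: "prob_space uniform_half"
  unfolding uniform_half_def by (rule prob_space_uniform_measure) auto

lemma uniform_half_cos_mean:
  fixes a :: real
  assumes "a \<noteq> 0"
  shows "(\<integral>x. cos (a * x) \<partial>uniform_half) = 2 / a * sin (a / 2)"
proof -
  have "(\<integral>x. cos (a * x) \<partial>uniform_half)
      = (\<integral>x. indicator {- 1 / 2 <..< 1 / 2 :: real} x *\<^sub>R cos (a * x) \<partial>lborel)"
    unfolding uniform_half_eq_density ennreal_indicator [symmetric]
    by (subst integral_density) auto
  also have "\<dots> = (LBINT x = ereal (- 1 / 2) .. ereal (1 / 2). cos (a * x))"
    by (simp add: interval_lebesgue_integral_def set_lebesgue_integral_def)
  also have "\<dots> = sin (a * (1 / 2)) / a - sin (a * (- 1 / 2)) / a"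
  proof (rule interval_integral_FTC_finite)
    show "((\<lambda>x. sin (a * x) / a) has_vector_derivative cos (a * x))
        (at x within {min (- 1 / 2) (1 / 2)..max (- 1 / 2) (1 / 2)})" for x :: real
      unfolding has_real_derivative_iff_has_vector_derivative [symmetric]
      using assms by (auto intro!: derivative_eq_intros)
  qed (intro continuous_intros)
  also have "\<dots> = 2 / a * sin (a / 2)"
    by simp
  finally show ?thesis .
qed

section \<open>Necessity\<close>

lemma cos_antiperiodic_pair:
  fixes u v m :: real
  assumes "m \<noteq> 0" and "\<bar>u + v\<bar> = m"
  shows "cos (pi / m * v) = - cos (pi / m * u)"
proof -
  consider "v = m - u" | "v = - m - u"
    using assms(2) by linarith
  then show ?thesis
  proof cases
    case 1
    then have "pi / m * v = pi - pi / m * u"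
      using assms(1) by (simp add: right_diff_distrib)
    then show ?thesis by simp
  next
    case 2
    then have "pi / m * v = - (pi / m * u + pi)"
      using assms(1) by (simp add: right_diff_distrib)
    then show ?thesis by (simp only: cos_minus cos_periodic_pi)
  qed
qed

lemma has_law_integral:
  fixes f :: "real \<Rightarrow> real"
  assumes "has_law M X \<mu>" and "f \<in> borel_measurable borel"
  shows "(\<integral>x. f (X x) \<partial>M) = (\<integral>x. f x \<partial>\<mu>)"
  using assms integral_distr [of X M borel f] by (auto simp: has_law_def)

lemma uniform_pair_constant_imp_admissible:
  assumes "uniform_pair_constant M U V m"
  shows "m \<in> admissible"
proof (cases "m = 0")
  case True
  then show ?thesis by (simp add: admissible_def)
next
  case False
  interpret prob_space M
    using assms by (simp add: uniform_pair_constant_def)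
  have U: "has_law M U uniform_half" and V: "has_law M V uniform_half"
    and ae: "AE x in M. \<bar>U x + V x\<bar> = m"
    using assms by (auto simp: uniform_pair_constant_def Psi_def)
  have [measurable]: "U \<in> borel_measurable M" "V \<in> borel_measurable M"
    using U V by (auto simp: has_law_def)
  from ae have "AE x in M. 0 \<le> m" by eventually_elim auto
  then have "m > 0" using False by simp
  let ?c = "\<lambda>x. cos (pi / m * x)"
  have "(\<integral>x. ?c x \<partial>uniform_half) = (\<integral>x. ?c (V x) \<partial>M)"
    by (rule has_law_integral [OF V, symmetric]) simp
  also have "\<dots> = (\<integral>x. - ?c (U x) \<partial>M)"
  proof (rule integral_cong_AE)
    show "AE x in M. ?c (V x) = - ?c (U x)"
      using ae by eventually_elim (rule cos_antiperiodic_pair [OF False])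
  qed simp_all
  also have "\<dots> = - (\<integral>x. ?c x \<partial>uniform_half)"
    using has_law_integral [OF U, of ?c] by simp
  finally have "(\<integral>x. ?c x \<partial>uniform_half) = 0" by simp
  then have "sin (pi / m / 2) = 0"
    using False uniform_half_cos_mean [of "pi / m"] by simp
  then obtain i :: int where "pi / m / 2 = of_int i * pi"
    by (auto simp: sin_zero_iff_int2)
  then have i: "of_int i = 1 / (2 * m)"
    using False by (simp add: field_simps)
  then have "(of_int i :: real) > 0" using \<open>m > 0\<close> by simp
  then have "i > 0" by simp
  then have "m = 1 / (2 * real (nat i))" "nat i \<ge> 1"
    using i False by (auto simp: field_simps)
  then show ?thesis unfolding admissible_def by blast
qed

section \<open>Sufficiency\<close>

lemma uniform_pair_constant_of_map:
  assumes T: "T \<in> borel_measurable borel"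
    and law: "distr uniform_half borel T = uniform_half"
    and ae: "AE x in uniform_half. \<bar>x + T x\<bar> = m"
  shows "\<exists>(M :: (real \<times> real) measure) U V. uniform_pair_constant M U V m"
proof -
  note T [measurable]
  let ?M = "distr uniform_half (borel \<Otimes>\<^sub>M borel) (\<lambda>x. (x, T x))"
  have "prob_space ?M"
    by (intro prob_space.prob_space_distr prob_space_uniform_half) simp
  moreover have "has_law ?M fst uniform_half"
    using distr_id2 [of borel uniform_half]
    by (simp add: has_law_def distr_distr comp_def id_def)
  moreover have "has_law ?M snd uniform_half"
    using law by (simp add: has_law_def distr_distr comp_def)
  moreover have "AE z in ?M. Psi (fst z) (snd z) = m"
    unfolding Psi_def using ae by (subst AE_distr_iff) simp_all
  ultimately show ?thesis
    unfolding uniform_pair_constant_def by blast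
qed

text \<open>
  A reflection preserves Lebesgue measure, hence also its restriction to any set symmetric under
  that reflection. Splitting the integral over \<open>E\<close> and its complement reduces the claim to the
  two reflections separately.
\<close>

lemma lborel_distr_piecewise_reflection:
  fixes E :: "real set" and a b :: real
  assumes E [measurable]: "E \<in> sets borel"
    and a: "\<And>x. a - x \<in> E \<longleftrightarrow> x \<in> E"
    and b: "\<And>x. b - x \<in> E \<longleftrightarrow> x \<in> E"
  shows "distr lborel borel (\<lambda>x. if x \<in> E then a - x else b - x) = lborel"
    (is "distr _ _ ?T = _")
proof (rule measure_eqI)
  fix A assume "A \<in> sets (distr lborel borel ?T)"
  then have [measurable]: "A \<in> sets borel" by simp
  have refl: "(\<integral>\<^sup>+x. f (c - x) \<partial>lborel) = (\<integral>\<^sup>+x. f x \<partial>lborel)"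
    if "f \<in> borel_measurable borel" for f and c :: real
    using nn_integral_real_affine [OF that, of "-1" c] by simp
  have "emeasure (distr lborel borel ?T) A = (\<integral>\<^sup>+x. indicator A (?T x) \<partial>lborel)"
    by (simp add: nn_integral_distr flip: nn_integral_indicator)
  also have "\<dots> = (\<integral>\<^sup>+x. indicator (A \<inter> E) (a - x) + indicator (A - E) (b - x) \<partial>lborel)"
    by (intro nn_integral_cong) (auto simp: indicator_def a b)
  also have "\<dots> = (\<integral>\<^sup>+x. indicator (A \<inter> E) x \<partial>lborel) + (\<integral>\<^sup>+x. indicator (A - E) x \<partial>lborel)"
    by (subst nn_integral_add) (simp_all add: refl)
  also have "\<dots> = (\<integral>\<^sup>+x. indicator (A \<inter> E) x + indicator (A - E) x \<partial>lborel)"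
    by (subst nn_integral_add) simp_all
  also have "\<dots> = (\<integral>\<^sup>+x. indicator A x \<partial>lborel)"
    by (intro nn_integral_cong) (auto simp: indicator_def)
  finally show "emeasure (distr lborel borel ?T) A = emeasure lborel A"
    by simp
qed simp

lemma uniform_half_distr_of_lborel:
  assumes T [measurable]: "T \<in> borel_measurable borel"
    and law: "distr lborel borel T = lborel"
    and inv: "AE x in lborel. T x \<in> {- 1 / 2 <..< 1 / 2} \<longleftrightarrow> x \<in> {- 1 / 2 <..< 1 / 2 :: real}"
  shows "distr uniform_half borel T = uniform_half"
proof -
  let ?I = "{- 1 / 2 <..< 1 / 2 :: real}"
  have "uniform_half = density (distr lborel borel T) (indicator ?I)"
    by (simp add: law uniform_half_eq_density)
  also have "\<dots> = distr (density lborel (\<lambda>x. indicator ?I (T x))) borel T"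
    by (rule density_distr) simp_all
  also have "density lborel (\<lambda>x. indicator ?I (T x)) = uniform_half"
    unfolding uniform_half_eq_density
    using inv by (intro density_cong) (auto simp: indicator_def elim!: eventually_mono)
  finally show ?thesis by simp
qed

lemma exists_uniform_pair_zero:
  "\<exists>(M :: (real \<times> real) measure) U V. uniform_pair_constant M U V 0"
proof (rule uniform_pair_constant_of_map)
  show "distr uniform_half borel uminus = uniform_half"
  proof (rule uniform_half_distr_of_lborel)
    show "distr lborel borel uminus = (lborel :: real measure)"
      using lborel_distr_piecewise_reflection [of UNIV 0 0] by simp
  qed auto
qed simp_all

text \<open>
  The phase \<open>(x + 1 / 2) / m\<close> runs over \<open>(0, 2 N)\<close>, so the sign of \<open>sin (\<pi> (x + 1 / 2) / m)\<close>
  tells the odd-numbered cells from the even-numbered ones. Describing the cells by this sine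
  makes their symmetry under both reflections a matter of periodicity. Cell endpoints are a null
  set, and the only ones that need attention are those whose image leaves or enters the interval.
\<close>

lemma exists_uniform_pair_reciprocal_even:
  fixes N :: nat
  assumes "N \<ge> 1" and m: "m = 1 / (2 * real N)"
  shows "\<exists>(M :: (real \<times> real) measure) U V. uniform_pair_constant M U V m"
proof -
  have "m > 0" using assms by simp
  define s where "s x = sin (pi * ((x + 1 / 2) / m))" for x
  define E where "E = {x. s x \<ge> 0}"
  define T where "T x = (if x \<in> E then - m - x else m - x)" for x
  have [measurable]: "s \<in> borel_measurable borel"
    unfolding s_def by simp
  have E_meas [measurable]: "E \<in> sets borel"
    unfolding E_def by simp
  have T_meas [measurable]: "T \<in> borel_measurable borel"
    unfolding T_def by simp
  have m_inv: "1 / m = 2 * real N"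
    using assms by simp
  have s_reflect: "s (- m - x) = s x" for x
  proof -
    have "pi * ((- m - x + 1 / 2) / m) = 2 * real N * pi - (pi * ((x + 1 / 2) / m) + pi)"
      unfolding m_inv [symmetric] using \<open>m > 0\<close> by (simp add: field_simps)
    then show ?thesis
      unfolding s_def by (simp only: sin_diff sin_add cos_add cos_2npi sin_2npi) simp
  qed
  have s_period: "s (x + 2 * m) = s x" for x
  proof -
    have "pi * ((x + 2 * m + 1 / 2) / m) = pi * ((x + 1 / 2) / m) + 2 * pi"
      using \<open>m > 0\<close> by (simp add: field_simps)
    then show ?thesis unfolding s_def by (simp only: sin_periodic)
  qed
  have s_reflect': "s (m - x) = s x" for x
    using s_period [of "- m - x"] s_reflect [of x] by (simp add: algebra_simps)
  have first_cell: "x \<in> E" if "- 1 / 2 < x" "x \<le> m - 1 / 2" for x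
  proof -
    have "0 \<le> (x + 1 / 2) / m" "(x + 1 / 2) / m \<le> 1"
      using that \<open>m > 0\<close> by simp_all
    then have "0 \<le> pi * ((x + 1 / 2) / m)" "pi * ((x + 1 / 2) / m) \<le> pi"
      using mult_left_le [of "(x + 1 / 2) / m" pi] by (simp_all only: mult_nonneg_nonneg pi_ge_zero)
    then show ?thesis
      unfolding E_def s_def by (auto intro: sin_ge_zero)
  qed
  have last_cell: "x \<notin> E" if "1 / 2 - m < x" "x < 1 / 2" for x
  proof -
    have "s x = s (- m - x)" by (simp add: s_reflect)
    \<comment> \<open>The point \<open>-m - x\<close> lies in the cell of length \<open>m\<close> just before the interval.\<close>
    also have "\<dots> = sin (- (pi * ((x + m - 1 / 2) / m)))"
      unfolding s_def by (rule arg_cong [of _ _ sin]) (use \<open>m > 0\<close> in \<open>simp add: field_simps\<close>)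
    also have "\<dots> < 0"
    proof -
      have "0 < (x + m - 1 / 2) / m" "(x + m - 1 / 2) / m < 1"
        using that \<open>m > 0\<close> by simp_all
      then have "0 < pi * ((x + m - 1 / 2) / m)" "pi * ((x + m - 1 / 2) / m) < pi * 1"
        by (simp_all only: mult_pos_pos pi_gt_zero mult_less_cancel_left_pos)
      then show ?thesis
        using sin_gt_zero [of "pi * ((x + m - 1 / 2) / m)"] by simp
    qed
    finally show ?thesis by (simp add: E_def)
  qed
  have T_invol: "T (T x) = x" for x
    by (simp add: T_def E_def s_reflect s_reflect')
  have T_into: "T x \<in> {- 1 / 2 <..< 1 / 2}"
    if "x \<in> {- 1 / 2 <..< 1 / 2}" "x \<noteq> 1 / 2 - m" for x
    using that first_cell [of x] last_cell [of x] \<open>m > 0\<close>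
    by (cases "x \<in> E") (force simp: T_def)+
  show ?thesis
  proof (rule uniform_pair_constant_of_map [OF T_meas])
    show "distr uniform_half borel T = uniform_half"
    proof (rule uniform_half_distr_of_lborel [OF T_meas])
      show "distr lborel borel T = lborel"
        unfolding T_def
        by (rule lborel_distr_piecewise_reflection)
          (simp_all add: E_meas, simp_all add: E_def s_reflect s_reflect')
      show "AE x in lborel. T x \<in> {- 1 / 2 <..< 1 / 2} \<longleftrightarrow> x \<in> {- 1 / 2 <..< 1 / 2}"
        using AE_lborel_singleton [of "1 / 2 - m"] AE_lborel_singleton [of "T (1 / 2 - m)"]
      proof eventually_elim
        case (elim x)
        \<comment> \<open>As \<open>T\<close> is an involution, the converse implication is the direct one at \<open>T x\<close>.\<close>
        have "T x \<noteq> 1 / 2 - m"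
          using elim(2) T_invol [of x] by metis
        then show ?case
          using elim(1) T_into [of x] T_into [of "T x"] T_invol [of x] by metis
      qed
    qed
    show "AE x in uniform_half. \<bar>x + T x\<bar> = m"
      using \<open>m > 0\<close> by (simp add: T_def)
  qed
qed

theorem lemma2p3:
  fixes m :: real
  shows "((\<exists>(M :: (real \<times> real) measure) U V. uniform_pair_constant M U V m) \<longleftrightarrow> m \<in> admissible) \<and>
         (\<forall>(M :: 'a measure) U V. uniform_pair_constant M U V m \<longrightarrow> m \<in> admissible)"
proof -
  have "\<exists>(M :: (real \<times> real) measure) U V. uniform_pair_constant M U V m"
    if "m \<in> admissible"
    using that exists_uniform_pair_zero exists_uniform_pair_reciprocal_even [OF _ refl]
    unfolding admissible_def by auto
  then show ?thesis
    by (auto intro: uniform_pair_constant_imp_admissible)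
qed

end
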